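(* For every $t\ge0$, the set $\mathcal R_{\boldsymbol r}(t)$ of positions reachable at time $t$ is the closed ball in $\mathbb R^n$ with center $\boldsymbol v_0(1-e^{-t})$ and radius $t-1+e^{-t}$, and the set $\mathcal R_{\boldsymbol v}(t)$ of velocities reachable at time $t$ is the closed ball in $\mathbb R^n$ with center $\boldsymbol v_0e^{-t}$ and radius $1-e^{-t}$. Consequently, for every $\mathbf h\in\mathbb R^n$, $$\rho_{\mathcal R_{\boldsymbol r}}(t,\mathbf h)=\max\left(0,\ \lVert\mathbf h-\boldsymbol v_0(1-e^{-t})\rVert-(t-1+e^{-t})\right),$$ $$\rho_{\mathcal R_{\boldsymbol v}}(t,\mathbf h)=\max\left(0,\ \lVert\mathbf h-\boldsymbol v_0e^{-t}\rVert-(1-e^{-t})\right).$$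
   Context: Let $n\in\mathbb N$, $n\ge1$; $\lVert\cdot\rVert$ is the Euclidean norm. Fix $v_0\in[0,1)$ and $\boldsymbol v_0=(v_0,0,\dots,0)\in\mathbb R^n$. The set of admissible controls $\mathcal A$ consists of measurable functions $\boldsymbol u$ of time $t\ge0$ with values in the closed unit ball of $\mathbb R^n$. For $\boldsymbol u\in\mathcal A$, the position $\boldsymbol r(\cdot;\boldsymbol u)$ and velocity $\boldsymbol v(\cdot;\boldsymbol u)$ are the absolutely continuous solutions of $\dot{\boldsymbol r}=\boldsymbol v$, $\dot{\boldsymbol v}=\boldsymbol u-\boldsymbol v$ (a.e.) with $\boldsymbol r(0;\boldsymbol u)=\boldsymbol 0$, $\boldsymbol v(0;\boldsymbol u)=\boldsymbol v_0$. Define $\mathcal R_{\boldsymbol r}(t)=\{\boldsymbol r(t;\boldsymbol u):\boldsymbol u\in\mathcal A\}$ and $\mathcal R_{\boldsymbol v}(t)=\{\boldsymbol v(t;\boldsymbol u):\boldsymbol u\in\mathcal A\}$ (the projections of the reachable set onto position and velocity space), and the distances $\rho_{\mathcal R_{\boldsymbol r}}(t,\mathbf h)=\min_{\tilde{\mathbf h}\in\mathcal R_{\boldsymbol r}(t)}\lVert\mathbf h-\tilde{\mathbf h}\rVert$, $\rho_{\mathcal R_{\boldsymbol v}}(t,\mathbf h)=\min_{\tilde{\mathbf h}\in\mathcal R_{\boldsymbol v}(t)}\lVert\mathbf h-\tilde{\mathbf h}\rVert$. A ball of radius $0$ is a single point. *)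

theory Defs
  imports "HOL-Analysis.Analysis"
begin

definition absolutely_continuous_fun_on ::
    "real \<Rightarrow> real \<Rightarrow> (real \<Rightarrow> 'a::real_normed_vector) \<Rightarrow> bool" where
  "absolutely_continuous_fun_on a b f \<longleftrightarrow>
     (\<forall>\<epsilon>>0. \<exists>\<delta>>0. \<forall>(I::nat set) x y.
        finite I \<and> (\<forall>i\<in>I. a \<le> x i \<and> x i \<le> y i \<and> y i \<le> b) \<and>
        disjoint_family_on (\<lambda>i. {x i<..<y i}) I \<and> (\<Sum>i\<in>I. y i - x i) < \<delta>
        \<longrightarrow> (\<Sum>i\<in>I. norm (f (y i) - f (x i))) < \<epsilon>)"

(* Controls and trajectories are total functions on the reals of which only the
   restriction to [0, \<infinity>) matters; \<real>^n is "real ^ 'n" with n = CARD('n) \<ge> 1, and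
   (v0, 0, ..., 0) is axis k v0, where the index k stands for the first coordinate. *)

definition admissible_controls :: "(real \<Rightarrow> real ^ 'n) set" where
  "admissible_controls =
     {u. u \<in> borel_measurable (lebesgue_on {0..}) \<and> (\<forall>t\<ge>0. u t \<in> cball 0 1)}"

definition is_trajectory ::
    "real ^ 'n \<Rightarrow> (real \<Rightarrow> real ^ 'n) \<Rightarrow> (real \<Rightarrow> real ^ 'n) \<Rightarrow> (real \<Rightarrow> real ^ 'n) \<Rightarrow> bool" where
  "is_trajectory w u r v \<longleftrightarrow>
     (\<forall>T\<ge>0. absolutely_continuous_fun_on 0 T r \<and> absolutely_continuous_fun_on 0 T v) \<and>
     (AE t in lebesgue_on {0..}.
        (r has_vector_derivative v t) (at t within {0..}) \<and>
        (v has_vector_derivative u t - v t) (at t within {0..})) \<and>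
     r 0 = 0 \<and> v 0 = w"

definition reach_position :: "real ^ 'n \<Rightarrow> real \<Rightarrow> (real ^ 'n) set" where
  "reach_position w t = {r t | u r v. u \<in> admissible_controls \<and> is_trajectory w u r v}"

definition reach_velocity :: "real ^ 'n \<Rightarrow> real \<Rightarrow> (real ^ 'n) set" where
  "reach_velocity w t = {v t | u r v. u \<in> admissible_controls \<and> is_trajectory w u r v}"

(* A genuine minimum: if the infimum over S were not attained, the value would be
   unspecified (unlike for the library's infdist). *)
definition min_distance :: "(real ^ 'n) set \<Rightarrow> real ^ 'n \<Rightarrow> real" where
  "min_distance S h = (LEAST d. d \<in> (\<lambda>h'. norm (h - h')) ` S)"

end

theory Submission
  imports Defs
begin

text \<open>
  Both reachable sets are balls because the dynamics is linear: the control enters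
  \<open>v(t)\<close> and \<open>r(t)\<close> through integrals against the nonnegative kernels \<open>e\<^sup>s\<^sup>-\<^sup>t\<close> and
  \<open>1 - e\<^sup>s\<^sup>-\<^sup>t\<close>, whose total masses over \<open>[0, t]\<close> are the two radii. An integral of a
  unit-ball valued function against such a kernel is bounded by the mass
  of the kernel, and constant controls already fill out the whole ball
  (\<open>constant_control_is_trajectory\<close>, \<open>cball_eq_image_unit_cball\<close>).

  The upper bounds are obtained without any integration. Differentiation removes the
  drift: \<open>(e\<^sup>t v)' = e\<^sup>t u\<close> almost everywhere, so the speed of \<open>e\<^sup>t v\<close> is at most
  \<open>(e\<^sup>t)'\<close> (\<open>is_trajectory_velocity_bound\<close>). That bound on \<open>v\<close> says in turn that the speed of
  \<open>r + e\<^sup>-\<^sup>t w\<close> is at most \<open>(t + e\<^sup>-\<^sup>t)'\<close> (\<open>is_trajectory_position_bound\<close>).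
  In both cases a mean value inequality for absolutely continuous functions whose derivative is
  bounded only almost everywhere (\<open>norm_increment_le_of_AE_derivative\<close>) concludes.
  It is proved directly by cutting the interval finely around its points: at points where the
  derivatives exist, increments compare up to a small multiple of the length; the pieces around
  the exceptional points have small total length, so absolute continuity makes their total
  contribution small.

  The distance formulas are then the distance from a point to a ball, attained at the
  radial projection.
\<close>

section \<open>Absolutely continuous functions\<close>

text \<open>
  Absolute continuity speaks of families indexed by sets of naturals; the pieces of a tagged
  division are more conveniently indexed by themselves.
\<close>

lemma absolutely_continuous_fun_on_imp_finite_family:
  fixes f :: "real \<Rightarrow> 'a::real_normed_vector"
  assumes "absolutely_continuous_fun_on a b f" and "\<epsilon> > 0"
  shows "\<exists>\<delta>>0. \<forall>(I :: 'i set) x y.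
           finite I \<and> (\<forall>i\<in>I. a \<le> x i \<and> x i \<le> y i \<and> y i \<le> b) \<and>
           disjoint_family_on (\<lambda>i. {x i<..<y i}) I \<and> (\<Sum>i\<in>I. y i - x i) < \<delta>
           \<longrightarrow> (\<Sum>i\<in>I. norm (f (y i) - f (x i))) < \<epsilon>"
proof -
  obtain \<delta> where "\<delta> > 0" and \<delta>: "\<forall>(I::nat set) x y.
        finite I \<and> (\<forall>i\<in>I. a \<le> x i \<and> x i \<le> y i \<and> y i \<le> b) \<and>
        disjoint_family_on (\<lambda>i. {x i<..<y i}) I \<and> (\<Sum>i\<in>I. y i - x i) < \<delta>
        \<longrightarrow> (\<Sum>i\<in>I. norm (f (y i) - f (x i))) < \<epsilon>"
    using assms(1)[unfolded absolutely_continuous_fun_on_def, THEN spec, THEN mp, OF assms(2)] by blast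
  have "(\<Sum>i\<in>I. norm (f (y i) - f (x i))) < \<epsilon>"
    if I: "finite I" "\<forall>i\<in>I. a \<le> x i \<and> x i \<le> y i \<and> y i \<le> b"
      "disjoint_family_on (\<lambda>i. {x i<..<y i}) I" "(\<Sum>i\<in>I. y i - x i) < \<delta>"
    for I :: "'i set" and x y
  proof -
    obtain e where e: "bij_betw e {0..<card I} I"
      using ex_bij_betw_nat_finite[OF I(1)] by blast
    have "(\<Sum>j\<in>{0..<card I}. norm (f (y (e j)) - f (x (e j)))) < \<epsilon>"
    proof (rule \<delta>[THEN spec, THEN spec, THEN spec, THEN mp], intro conjI ballI)
      show "disjoint_family_on (\<lambda>j. {x (e j)<..<y (e j)}) {0..<card I}"
        unfolding disjoint_family_on_def
      proof (intro ballI impI)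
        fix m n assume mn: "m \<in> {0..<card I}" "n \<in> {0..<card I}" "m \<noteq> n"
        then have "e m \<noteq> e n" "e m \<in> I" "e n \<in> I"
          using bij_betw_imp_inj_on[OF e] bij_betwE[OF e] by (auto dest: inj_onD)
        with I(3) show "{x (e m)<..<y (e m)} \<inter> {x (e n)<..<y (e n)} = {}"
          unfolding disjoint_family_on_def by blast
      qed
      show "(\<Sum>j\<in>{0..<card I}. y (e j) - x (e j)) < \<delta>"
        using I(4) sum.reindex_bij_betw[OF e, of "\<lambda>i. y i - x i"] by simp
    qed (use I(2) bij_betwE[OF e] in auto)
    then show "(\<Sum>i\<in>I. norm (f (y i) - f (x i))) < \<epsilon>"
      using sum.reindex_bij_betw[OF e, of "\<lambda>i. norm (f (y i) - f (x i))"] by simp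
  qed
  with \<open>\<delta> > 0\<close> show ?thesis by blast
qed

lemma absolutely_continuous_fun_on_imp_continuous_on:
  fixes f :: "real \<Rightarrow> 'a::real_normed_vector"
  assumes "absolutely_continuous_fun_on a b f"
  shows "continuous_on {a..b} f"
proof (rule continuous_onI)
  fix x and \<epsilon> :: real assume x: "x \<in> {a..b}" and "\<epsilon> > 0"
  obtain \<delta> where "\<delta> > 0" and \<delta>: "\<forall>(I::nat set) x y.
        finite I \<and> (\<forall>i\<in>I. a \<le> x i \<and> x i \<le> y i \<and> y i \<le> b) \<and>
        disjoint_family_on (\<lambda>i. {x i<..<y i}) I \<and> (\<Sum>i\<in>I. y i - x i) < \<delta>
        \<longrightarrow> (\<Sum>i\<in>I. norm (f (y i) - f (x i))) < \<epsilon>"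
    using assms[unfolded absolutely_continuous_fun_on_def, THEN spec, THEN mp, OF \<open>\<epsilon> > 0\<close>] by blast
  have "dist (f y) (f x) \<le> \<epsilon>" if "y \<in> {a..b}" "dist y x < \<delta>" for y
    using \<delta>[rule_format, of "{0}" "\<lambda>_. min x y" "\<lambda>_. max x y"] that x
    by (cases "x \<le> y")
       (auto simp: disjoint_family_on_def dist_norm norm_minus_commute)
  with \<open>\<delta> > 0\<close> show "\<exists>d>0. \<forall>x'\<in>{a..b}. dist x' x < d \<longrightarrow> dist (f x') (f x) \<le> \<epsilon>"
    by blast
qed

text \<open>
  A single transfer principle yields closure under sums and products as well as the
  absolute continuity of Lipschitz functions (with the identity in place of both \<open>f\<close> and \<open>g\<close>).
\<close>

lemma absolutely_continuous_fun_on_of_dominated: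
  fixes f :: "real \<Rightarrow> 'a::real_normed_vector" and g :: "real \<Rightarrow> 'b::real_normed_vector"
    and h :: "real \<Rightarrow> 'c::real_normed_vector"
  assumes f: "absolutely_continuous_fun_on a b f" and g: "absolutely_continuous_fun_on a b g"
    and le: "\<And>x y. a \<le> x \<Longrightarrow> x \<le> y \<Longrightarrow> y \<le> b \<Longrightarrow>
               norm (h y - h x) \<le> C * (norm (f y - f x) + norm (g y - g x))"
  shows "absolutely_continuous_fun_on a b h"
  unfolding absolutely_continuous_fun_on_def
proof (intro allI impI)
  fix \<epsilon> :: real assume "\<epsilon> > 0"
  define \<eta> where "\<eta> = \<epsilon> / (2 * (\<bar>C\<bar> + 1))"
  have "\<eta> > 0" using \<open>\<epsilon> > 0\<close> by (simp add: \<eta>_def add_nonneg_pos)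
  obtain d where "d > 0" and d: "\<forall>(I::nat set) x y.
        finite I \<and> (\<forall>i\<in>I. a \<le> x i \<and> x i \<le> y i \<and> y i \<le> b) \<and>
        disjoint_family_on (\<lambda>i. {x i<..<y i}) I \<and> (\<Sum>i\<in>I. y i - x i) < d
        \<longrightarrow> (\<Sum>i\<in>I. norm (f (y i) - f (x i))) < \<eta>"
    using f[unfolded absolutely_continuous_fun_on_def, THEN spec, THEN mp, OF \<open>\<eta> > 0\<close>] by blast
  obtain d' where "d' > 0" and d': "\<forall>(I::nat set) x y.
        finite I \<and> (\<forall>i\<in>I. a \<le> x i \<and> x i \<le> y i \<and> y i \<le> b) \<and>
        disjoint_family_on (\<lambda>i. {x i<..<y i}) I \<and> (\<Sum>i\<in>I. y i - x i) < d'
        \<longrightarrow> (\<Sum>i\<in>I. norm (g (y i) - g (x i))) < \<eta>"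
    using g[unfolded absolutely_continuous_fun_on_def, THEN spec, THEN mp, OF \<open>\<eta> > 0\<close>] by blast
  show "\<exists>\<delta>>0. \<forall>(I::nat set) x y. finite I \<and> (\<forall>i\<in>I. a \<le> x i \<and> x i \<le> y i \<and> y i \<le> b) \<and>
      disjoint_family_on (\<lambda>i. {x i<..<y i}) I \<and> (\<Sum>i\<in>I. y i - x i) < \<delta> \<longrightarrow>
      (\<Sum>i\<in>I. norm (h (y i) - h (x i))) < \<epsilon>"
  proof (intro exI[of _ "min d d'"] conjI allI impI)
    fix I :: "nat set" and x y
    assume I: "finite I \<and> (\<forall>i\<in>I. a \<le> x i \<and> x i \<le> y i \<and> y i \<le> b) \<and>
      disjoint_family_on (\<lambda>i. {x i<..<y i}) I \<and> (\<Sum>i\<in>I. y i - x i) < min d d'"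
    let ?f = "\<Sum>i\<in>I. norm (f (y i) - f (x i))" and ?g = "\<Sum>i\<in>I. norm (g (y i) - g (x i))"
    have "(\<Sum>i\<in>I. norm (h (y i) - h (x i))) \<le>
        (\<Sum>i\<in>I. C * (norm (f (y i) - f (x i)) + norm (g (y i) - g (x i))))"
      by (rule sum_mono) (use I le in auto)
    also have "\<dots> = C * (?f + ?g)"
      by (simp flip: sum_distrib_left sum.distrib)
    also have "\<dots> \<le> (\<bar>C\<bar> + 1) * (?f + ?g)"
      by (intro mult_right_mono add_nonneg_nonneg sum_nonneg) auto
    also have "\<dots> < (\<bar>C\<bar> + 1) * (\<eta> + \<eta>)"
      using d[THEN spec, THEN spec, THEN spec, THEN mp, of I x y]
        d'[THEN spec, THEN spec, THEN spec, THEN mp, of I x y] I by (intro mult_strict_left_mono add_strict_mono) auto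
    also have "(\<bar>C\<bar> + 1) * (\<eta> + \<eta>) = \<epsilon>"
    proof -
      have "\<bar>C\<bar> + 1 \<noteq> 0" by linarith
      then show ?thesis by (simp add: \<eta>_def divide_simps)
    qed
    finally show "(\<Sum>i\<in>I. norm (h (y i) - h (x i))) < \<epsilon>" .
  qed (use \<open>d > 0\<close> \<open>d' > 0\<close> in auto)
qed

lemma absolutely_continuous_fun_on_add:
  fixes f g :: "real \<Rightarrow> 'a::real_normed_vector"
  assumes "absolutely_continuous_fun_on a b f" "absolutely_continuous_fun_on a b g"
  shows "absolutely_continuous_fun_on a b (\<lambda>x. f x + g x)"
  by (rule absolutely_continuous_fun_on_of_dominated[OF assms, where C = 1])
     (simp add: add_diff_add norm_triangle_ineq)

lemma absolutely_continuous_fun_on_scaleR: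
  fixes f :: "real \<Rightarrow> 'a::real_normed_vector" and \<phi> :: "real \<Rightarrow> real"
  assumes \<phi>: "absolutely_continuous_fun_on a b \<phi>" and f: "absolutely_continuous_fun_on a b f"
  shows "absolutely_continuous_fun_on a b (\<lambda>x. \<phi> x *\<^sub>R f x)"
proof -
  have "bounded (\<phi> ` {a..b})" "bounded (f ` {a..b})"
    using assms[THEN absolutely_continuous_fun_on_imp_continuous_on]
    by (auto intro!: compact_imp_bounded compact_continuous_image)
  then obtain A B where A: "\<And>x. x \<in> {a..b} \<Longrightarrow> norm (\<phi> x) \<le> A"
    and B: "\<And>x. x \<in> {a..b} \<Longrightarrow> norm (f x) \<le> B"
    unfolding bounded_iff by (metis imageI)
  show ?thesis
  proof (rule absolutely_continuous_fun_on_of_dominated[OF \<phi> f, where C = "max A B"])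
    fix x y assume xy: "a \<le> x" "x \<le> y" "y \<le> b"
    have "\<phi> y *\<^sub>R f y - \<phi> x *\<^sub>R f x = (\<phi> y - \<phi> x) *\<^sub>R f y + \<phi> x *\<^sub>R (f y - f x)"
      by (simp add: algebra_simps)
    also have "norm \<dots> \<le> norm (\<phi> y - \<phi> x) * norm (f y) + norm (\<phi> x) * norm (f y - f x)"
      by (metis norm_scaleR norm_triangle_ineq real_norm_def)
    also have "\<dots> \<le> norm (\<phi> y - \<phi> x) * max A B + max A B * norm (f y - f x)"
      using A[of x] B[of y] xy by (intro add_mono mult_left_mono mult_right_mono) auto
    finally show "norm (\<phi> y *\<^sub>R f y - \<phi> x *\<^sub>R f x) \<le>
        max A B * (norm (\<phi> y - \<phi> x) + norm (f y - f x))"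
      by (simp add: algebra_simps)
  qed
qed

lemma absolutely_continuous_fun_on_of_C1:
  fixes f :: "real \<Rightarrow> 'a::real_normed_vector"
  assumes deriv: "\<And>x. x \<in> {a..b} \<Longrightarrow> (f has_vector_derivative f' x) (at x within {a..b})"
    and cont: "continuous_on {a..b} f'"
  shows "absolutely_continuous_fun_on a b f"
proof -
  have "bounded (f' ` {a..b})"
    using cont by (auto intro!: compact_imp_bounded compact_continuous_image)
  then obtain C where C: "\<And>x. x \<in> {a..b} \<Longrightarrow> norm (f' x) \<le> C"
    unfolding bounded_iff by (metis imageI)
  have id: "absolutely_continuous_fun_on a b (\<lambda>x::real. x)"
    unfolding absolutely_continuous_fun_on_def
  proof (intro allI impI)
    fix \<epsilon> :: real assume "\<epsilon> > 0"
    have "(\<Sum>i\<in>I. norm (y i - x i)) = (\<Sum>i\<in>I. y i - x i)"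
      if "\<forall>i\<in>I. a \<le> x i \<and> x i \<le> y i \<and> y i \<le> b" for I :: "nat set" and x y :: "nat \<Rightarrow> real"
      using that by (intro sum.cong) auto
    then show "\<exists>\<delta>>0. \<forall>(I::nat set) x y. finite I \<and> (\<forall>i\<in>I. a \<le> x i \<and> x i \<le> y i \<and> y i \<le> b) \<and>
        disjoint_family_on (\<lambda>i. {x i<..<y i}) I \<and> (\<Sum>i\<in>I. y i - x i) < \<delta>
        \<longrightarrow> (\<Sum>i\<in>I. norm (y i - x i)) < \<epsilon>"
      using \<open>\<epsilon> > 0\<close> by (intro exI[of _ \<epsilon>]) simp
  qed
  show ?thesis
  proof (rule absolutely_continuous_fun_on_of_dominated[OF id id, where C = "\<bar>C\<bar>"])
    fix x y assume xy: "a \<le> x" "x \<le> y" "y \<le> b"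
    have "norm (f y - f x) \<le> C * norm (y - x)"
    proof (rule differentiable_bound[where S = "{a..b}" and f' = "\<lambda>x h. h *\<^sub>R f' x"])
      show "onorm (\<lambda>h. h *\<^sub>R f' z) \<le> C" if "z \<in> {a..b}" for z
        using C[OF that] by (simp add: onorm_scaleR_left bounded_linear_ident onorm_id)
    qed (use deriv xy in \<open>auto simp: has_vector_derivative_def\<close>)
    also have "\<dots> \<le> \<bar>C\<bar> * (norm (y - x) + norm (y - x))"
      by (intro mult_mono) auto
    finally show "norm (f y - f x) \<le> \<bar>C\<bar> * (norm (y - x) + norm (y - x))" .
  qed
qed

section \<open>A mean value inequality with exceptional null set\<close>

text \<open>
  The point \<open>x\<close> has to lie between \<open>y\<close> and \<open>z\<close>: the linearization errors on the two sides
  of \<open>x\<close> then add up to a multiple of \<open>z - y\<close>, which fails for general \<open>y\<close> and \<open>z\<close> near \<open>x\<close>.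
\<close>

lemma straddle_bound:
  fixes f :: "real \<Rightarrow> 'a::real_normed_vector"
  assumes f: "(f has_vector_derivative D) (at x within S)"
    and g: "(g has_real_derivative E) (at x within S)"
    and le: "norm D \<le> E" and "\<epsilon> > 0"
  obtains d where "d > 0"
    and "\<And>y z. y \<in> S \<Longrightarrow> z \<in> S \<Longrightarrow> y \<le> x \<Longrightarrow> x \<le> z \<Longrightarrow> y \<in> ball x d \<Longrightarrow> z \<in> ball x d \<Longrightarrow>
           norm (f z - f y) \<le> g z - g y + \<epsilon> * (z - y)"
proof -
  have e: "\<epsilon> / 2 > 0" using \<open>\<epsilon> > 0\<close> by simp
  obtain d1 where d1: "d1 > 0" "\<And>y. y \<in> S \<Longrightarrow> norm (y - x) < d1 \<Longrightarrow>
      norm (f y - f x - (y - x) *\<^sub>R D) \<le> \<epsilon> / 2 * norm (y - x)"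
    using f e unfolding has_vector_derivative_def has_derivative_within_alt by blast
  obtain d2 where d2: "d2 > 0" "\<And>y. y \<in> S \<Longrightarrow> norm (y - x) < d2 \<Longrightarrow>
      norm (g y - g x - E * (y - x)) \<le> \<epsilon> / 2 * norm (y - x)"
    using g e unfolding has_field_derivative_def has_derivative_within_alt by blast
  show thesis
  proof
    show "min d1 d2 > 0" using d1 d2 by simp
    fix y z assume yz: "y \<in> S" "z \<in> S" "y \<le> x" "x \<le> z" "y \<in> ball x (min d1 d2)" "z \<in> ball x (min d1 d2)"
    then have n: "norm (y - x) < d1" "norm (y - x) < d2" "norm (z - x) < d1" "norm (z - x) < d2"
      by (auto simp: dist_norm)
    have fz: "norm (f z - f x - (z - x) *\<^sub>R D) \<le> \<epsilon> / 2 * (z - x)"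
      and fy: "norm (f y - f x - (y - x) *\<^sub>R D) \<le> \<epsilon> / 2 * (x - y)"
      using d1(2)[of y] d1(2)[of z] n yz by simp_all
    have "\<bar>g z - g x - E * (z - x)\<bar> \<le> \<epsilon> / 2 * (z - x)"
      and "\<bar>g y - g x - E * (y - x)\<bar> \<le> \<epsilon> / 2 * (x - y)"
      using d2(2)[of y] d2(2)[of z] n yz by simp_all
    moreover have "E * (x - y) = - (E * (y - x))" by (simp add: algebra_simps)
    ultimately have gz: "E * (z - x) \<le> g z - g x + \<epsilon> / 2 * (z - x)"
      and gy: "E * (x - y) \<le> g x - g y + \<epsilon> / 2 * (x - y)"
      by (simp_all only: abs_le_iff) linarith+
    have "f z - f y = (z - y) *\<^sub>R D + (f z - f x - (z - x) *\<^sub>R D) - (f y - f x - (y - x) *\<^sub>R D)"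
      by (simp add: algebra_simps)
    also have "norm \<dots> \<le> norm ((z - y) *\<^sub>R D) + norm (f z - f x - (z - x) *\<^sub>R D)
        + norm (f y - f x - (y - x) *\<^sub>R D)"
      by (rule order_trans[OF norm_triangle_ineq4 add_right_mono[OF norm_triangle_ineq]])
    also have "\<dots> \<le> E * (z - y) + \<epsilon> / 2 * (z - x) + \<epsilon> / 2 * (x - y)"
      using mult_right_mono[OF le, of "z - y"] yz
      by (intro add_mono fz fy) (simp add: mult.commute)
    also have "E * (z - y) = E * (z - x) + E * (x - y)" by (simp add: algebra_simps)
    also have "E * (z - x) + E * (x - y) + \<epsilon> / 2 * (z - x) + \<epsilon> / 2 * (x - y)
        \<le> (g z - g x + \<epsilon> / 2 * (z - x)) + (g x - g y + \<epsilon> / 2 * (x - y))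
          + \<epsilon> / 2 * (z - x) + \<epsilon> / 2 * (x - y)"
      by (intro add_right_mono add_mono gz gy)
    also have "\<dots> = g z - g y + \<epsilon> * (z - y)"
      by (simp add: field_simps)
    finally show "norm (f z - f y) \<le> g z - g y + \<epsilon> * (z - y)" .
  qed
qed

text \<open>
  At the points of \<open>N\<close> nothing is known about derivatives. There the increments of \<open>f\<close> are
  small in total by absolute continuity, and those of \<open>g\<close> are nonnegative by monotonicity, so
  leaving them out only lowers the sum that has to stay below \<open>g b - g a\<close>.
\<close>

lemma norm_increment_le_of_AE_derivative:
  fixes f :: "real \<Rightarrow> 'a::real_normed_vector" and g :: "real \<Rightarrow> real"
  assumes "a \<le> b"
    and ac: "absolutely_continuous_fun_on a b f"
    and mono: "mono_on {a..b} g"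
    and null: "N \<in> null_sets lebesgue"
    and f': "\<And>x. x \<in> {a..b} - N \<Longrightarrow> (f has_vector_derivative f' x) (at x within {a..b})"
    and g': "\<And>x. x \<in> {a..b} - N \<Longrightarrow> (g has_real_derivative g' x) (at x within {a..b})"
    and le: "\<And>x. x \<in> {a..b} - N \<Longrightarrow> norm (f' x) \<le> g' x"
  shows "norm (f b - f a) \<le> g b - g a"
proof -
  have eps: "norm (f b - f a) \<le> g b - g a + \<epsilon> * (b - a + 1)" if "\<epsilon> > 0" for \<epsilon>
  proof -
    obtain \<delta> where "\<delta> > 0" and \<delta>: "\<forall>(I :: (real \<times> real set) set) x y.
           finite I \<and> (\<forall>i\<in>I. a \<le> x i \<and> x i \<le> y i \<and> y i \<le> b) \<and>
           disjoint_family_on (\<lambda>i. {x i<..<y i}) I \<and> (\<Sum>i\<in>I. y i - x i) < \<delta>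
           \<longrightarrow> (\<Sum>i\<in>I. norm (f (y i) - f (x i))) < \<epsilon>"
      using absolutely_continuous_fun_on_imp_finite_family[OF ac \<open>\<epsilon> > 0\<close>] by blast
    obtain U where U: "open U" "N \<subseteq> U" "emeasure lebesgue U < ennreal \<delta>"
    proof -
      obtain U where U: "open U" "N \<subseteq> U" "emeasure lebesgue (U - N) < ennreal \<delta>"
        using sets_lebesgue_outer_open[OF null_setsD2[OF null] \<open>\<delta> > 0\<close>] by metis
      moreover have "emeasure lebesgue (U - N) = emeasure lebesgue U"
        using U(1) by (intro emeasure_Diff_null_set null) auto
      ultimately show thesis using that by metis
    qed
    \<comment> \<open>The gauge: around exceptional points it stays inside \<open>U\<close>, which bounds the total length of
      the pieces there; elsewhere it is fine enough for the two linearizations.\<close>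
    have "\<exists>d>0. if x \<in> N then ball x d \<subseteq> U else
        x \<in> {a..b} \<longrightarrow> (\<forall>y\<in>{a..b}. \<forall>z\<in>{a..b}. y \<le> x \<and> x \<le> z \<and> y \<in> ball x d \<and> z \<in> ball x d
          \<longrightarrow> norm (f z - f y) \<le> g z - g y + \<epsilon> * (z - y))" for x
    proof (cases "x \<in> N")
      case True
      then show ?thesis using U openE by (metis subsetD)
    next
      case False
      show ?thesis
      proof (cases "x \<in> {a..b}")
        case True
        with False have x: "x \<in> {a..b} - N" by simp
        show ?thesis
          by (rule straddle_bound[OF f'[OF x] g'[OF x] le[OF x] that]) (use False in auto)
      qed (use False in \<open>auto intro: exI[of _ 1]\<close>)
    qed
    then obtain d where d: "\<And>x. d x > 0"
      and dN: "\<And>x. x \<in> N \<Longrightarrow> ball x (d x) \<subseteq> U"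
      and dG: "\<And>x y z. x \<in> {a..b} - N \<Longrightarrow> y \<in> {a..b} \<Longrightarrow> z \<in> {a..b} \<Longrightarrow> y \<le> x \<Longrightarrow> x \<le> z \<Longrightarrow>
          y \<in> ball x (d x) \<Longrightarrow> z \<in> ball x (d x) \<Longrightarrow> norm (f z - f y) \<le> g z - g y + \<epsilon> * (z - y)"
      by (metis DiffD1 DiffD2)
    have "gauge (\<lambda>x. ball x (d x))"
      using d by (simp add: gauge_def)
    then obtain p where p: "p tagged_division_of {a..b}" and fine: "(\<lambda>x. ball x (d x)) fine p"
      by (rule fine_division_exists_real)
    define l u :: "real \<times> real set \<Rightarrow> real" where "l i = Inf (snd i)" and "u i = Sup (snd i)" for i
    have fin: "finite p" using p by (rule tagged_division_of_finite)
    have interval: "snd i = {l i..u i} \<and> l i \<le> fst i \<and> fst i \<le> u i \<and> a \<le> l i \<and> u i \<le> b \<and> {l i..u i} \<subseteq> ball (fst i) (d (fst i))"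
      if "i \<in> p" for i
    proof -
      obtain x K where i: "i = (x, K)" by (cases i)
      have xK: "(x, K) \<in> p" using that i by simp
      obtain s t where "K = cbox s t"
        using tagged_division_ofD(4)[OF p xK] by blast
      moreover have "x \<in> K" "K \<subseteq> {a..b}" "K \<subseteq> ball x (d x)"
        using tagged_division_ofD(2,3)[OF p xK] fineD[OF fine xK] by auto
      ultimately show ?thesis
        by (simp add: i l_def u_def)
    qed
    have disj: "disjoint_family_on (\<lambda>i. {l i<..<u i}) p"
      unfolding disjoint_family_on_def
    proof (intro ballI impI)
      fix i j assume ij: "i \<in> p" "j \<in> p" "i \<noteq> j"
      then have "interior (snd i) \<inter> interior (snd j) = {}"
        using tagged_division_ofD(5)[OF p, of "fst i" "snd i" "fst j" "snd j"] by auto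
      then show "{l i<..<u i} \<inter> {l j<..<u j} = {}"
        using interval[OF ij(1)] interval[OF ij(2)] by simp
    qed
    \<comment> \<open>The pieces tagged by exceptional points.\<close>
    define B where "B = {i \<in> p. fst i \<in> N}"
    have B: "finite B" "B \<subseteq> p" using fin by (auto simp: B_def)
    have disjB: "disjoint_family_on (\<lambda>i. {l i<..<u i}) B"
      using disj B(2) by (rule disjoint_family_on_mono[rotated])
    have len: "l i \<le> u i" if "i \<in> B" for i
      using interval[of i] B(2) that by auto
    have "ennreal (\<Sum>i\<in>B. u i - l i) = (\<Sum>i\<in>B. emeasure lebesgue {l i<..<u i})"
      using len by (simp flip: sum_ennreal)
    also have "\<dots> = emeasure lebesgue (\<Union>i\<in>B. {l i<..<u i})"
      by (rule sum_emeasure[OF _ disjB B(1)]) auto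
    also have "\<dots> \<le> emeasure lebesgue U"
    proof (rule emeasure_mono)
      show "(\<Union>i\<in>B. {l i<..<u i}) \<subseteq> U"
      proof (rule UN_least)
        fix i assume "i \<in> B"
        then have "{l i..u i} \<subseteq> U"
          using interval[of i] dN[of "fst i"] by (auto simp: B_def)
        then show "{l i<..<u i} \<subseteq> U"
          using greaterThanLessThan_subseteq_atLeastAtMost_iff by force
      qed
    qed (use U(1) in auto)
    also have "\<dots> < ennreal \<delta>" by fact
    finally have "(\<Sum>i\<in>B. u i - l i) < \<delta>"
      using len by (subst (asm) ennreal_less_iff) (auto intro!: sum_nonneg)
    then have bad: "(\<Sum>i\<in>B. norm (f (u i) - f (l i))) < \<epsilon>"
      using interval B disjB by (intro \<delta>[THEN spec, THEN spec, THEN spec, THEN mp]) force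
    have "norm (f b - f a) = norm (\<Sum>i\<in>p. f (u i) - f (l i))"
      using additive_tagged_division_1[OF \<open>a \<le> b\<close> p, of f] by (simp add: l_def u_def case_prod_beta)
    also have "\<dots> \<le> (\<Sum>i\<in>p. norm (f (u i) - f (l i)))"
      by (rule norm_sum)
    also have "\<dots> = (\<Sum>i\<in>B. norm (f (u i) - f (l i))) + (\<Sum>i\<in>p - B. norm (f (u i) - f (l i)))"
      using fin B(2) by (simp add: sum.subset_diff)
    also have "\<dots> \<le> \<epsilon> + (\<Sum>i\<in>p. (g (u i) - g (l i)) + \<epsilon> * (u i - l i))"
    proof (intro add_mono less_imp_le[OF bad])
      have "(\<Sum>i\<in>p - B. norm (f (u i) - f (l i))) \<le> (\<Sum>i\<in>p - B. (g (u i) - g (l i)) + \<epsilon> * (u i - l i))"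
      proof (rule sum_mono)
        fix i assume "i \<in> p - B"
        then have "i \<in> p" "fst i \<notin> N" by (auto simp: B_def)
        then show "norm (f (u i) - f (l i)) \<le> (g (u i) - g (l i)) + \<epsilon> * (u i - l i)"
          using interval[of i] subsetD[of "{l i..u i}" "ball (fst i) (d (fst i))" "l i"]
            subsetD[of "{l i..u i}" "ball (fst i) (d (fst i))" "u i"]
          by (intro dG[of "fst i"]) auto
      qed
      also have "\<dots> \<le> (\<Sum>i\<in>p. (g (u i) - g (l i)) + \<epsilon> * (u i - l i))"
      proof (rule sum_mono2[OF fin])
        fix i assume "i \<in> p - (p - B)"
        then have "i \<in> p" by simp
        from interval[OF this] have "g (l i) \<le> g (u i)" "0 \<le> \<epsilon> * (u i - l i)"
          using that by (auto intro!: mono_onD[OF mono])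
        then show "0 \<le> (g (u i) - g (l i)) + \<epsilon> * (u i - l i)" by simp
      qed auto
      finally show "(\<Sum>i\<in>p - B. norm (f (u i) - f (l i))) \<le>
          (\<Sum>i\<in>p. (g (u i) - g (l i)) + \<epsilon> * (u i - l i))" .
    qed
    also have "(\<Sum>i\<in>p. (g (u i) - g (l i)) + \<epsilon> * (u i - l i)) = (g b - g a) + \<epsilon> * (b - a)"
      using additive_tagged_division_1[OF \<open>a \<le> b\<close> p, of g]
        additive_tagged_division_1[OF \<open>a \<le> b\<close> p, of "\<lambda>x. x"]
      by (simp add: l_def u_def case_prod_beta sum.distrib flip: sum_distrib_left)
    finally show ?thesis by (simp add: algebra_simps)
  qed
  have "norm (f b - f a) \<le> g b - g a + e" if "e > 0" for e
  proof -
    have "b - a + 1 > 0" using \<open>a \<le> b\<close> by simp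
    then show ?thesis using eps[of "e / (b - a + 1)"] that by simp
  qed
  then show ?thesis by (rule field_le_epsilon)
qed


section \<open>Reachable positions and velocities\<close>

text \<open>
  The integrating factor \<open>e\<^sup>t\<close> turns \<open>v' = u - v\<close> into \<open>(e\<^sup>t v)' = e\<^sup>t u\<close>, whose norm is at most the
  derivative of \<open>e\<^sup>t\<close>.
\<close>

lemma is_trajectory_velocity_bound:
  assumes u: "u \<in> admissible_controls" and traj: "is_trajectory w u r v" and "0 \<le> t"
  shows "norm (v t - exp (- t) *\<^sub>R w) \<le> 1 - exp (- t)"
proof -
  obtain N where N: "N \<in> null_sets lebesgue"
    and v': "\<And>x. x \<ge> 0 \<Longrightarrow> x \<notin> N \<Longrightarrow> (v has_vector_derivative u x - v x) (at x within {0..})"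
    using traj unfolding is_trajectory_def
    by (auto elim!: AE_E3 simp: null_sets_restrict_space)
  have "norm (exp t *\<^sub>R v t - exp 0 *\<^sub>R v 0) \<le> exp t - exp 0"
  proof (rule norm_increment_le_of_AE_derivative[OF \<open>0 \<le> t\<close> _ _ N])
    have "absolutely_continuous_fun_on 0 t (exp :: real \<Rightarrow> real)"
      by (rule absolutely_continuous_fun_on_of_C1[where f' = exp])
         (auto intro!: derivative_eq_intros continuous_intros simp flip: has_real_derivative_iff_has_vector_derivative)
    then show "absolutely_continuous_fun_on 0 t (\<lambda>x. exp x *\<^sub>R v x)"
      using traj \<open>0 \<le> t\<close> by (intro absolutely_continuous_fun_on_scaleR) (auto simp: is_trajectory_def)
  next
    fix x assume x: "x \<in> {0..t} - N"
    then have "(v has_vector_derivative u x - v x) (at x within {0..t})"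
      by (intro has_vector_derivative_within_subset[OF v']) auto
    from has_vector_derivative_scaleR[OF DERIV_exp[THEN DERIV_subset] this]
    show "((\<lambda>x. exp x *\<^sub>R v x) has_vector_derivative exp x *\<^sub>R u x) (at x within {0..t})"
      by (simp add: algebra_simps)
    show "(exp has_real_derivative exp x) (at x within {0..t})"
      by (auto intro!: derivative_eq_intros)
    show "norm (exp x *\<^sub>R u x) \<le> exp x"
      using u x by (simp add: admissible_controls_def)
  qed (auto intro!: mono_onI)
  moreover have "v 0 = w" using traj by (simp add: is_trajectory_def)
  ultimately have le: "norm (exp t *\<^sub>R v t - w) \<le> exp t - 1" by simp
  have "v t - exp (- t) *\<^sub>R w = exp (- t) *\<^sub>R (exp t *\<^sub>R v t - w)"
    by (simp add: algebra_simps flip: exp_add)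
  also have "norm \<dots> \<le> exp (- t) * (exp t - 1)"
    using le by simp
  also have "\<dots> = 1 - exp (- t)"
    by (simp add: algebra_simps flip: exp_add)
  finally show ?thesis .
qed

text \<open>
  By the velocity bound, \<open>r' = v\<close> stays within \<open>1 - e\<^sup>-\<^sup>t\<close> of \<open>e\<^sup>-\<^sup>t w\<close>. Adding \<open>e\<^sup>-\<^sup>t w\<close> to \<open>r\<close> subtracts that
  center from the derivative, and \<open>1 - e\<^sup>-\<^sup>t\<close> is the derivative of \<open>t + e\<^sup>-\<^sup>t\<close>.
\<close>

lemma is_trajectory_position_bound:
  assumes u: "u \<in> admissible_controls" and traj: "is_trajectory w u r v" and "0 \<le> t"
  shows "norm (r t - (1 - exp (- t)) *\<^sub>R w) \<le> t - 1 + exp (- t)"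
proof -
  obtain N where N: "N \<in> null_sets lebesgue"
    and r': "\<And>x. x \<ge> 0 \<Longrightarrow> x \<notin> N \<Longrightarrow> (r has_vector_derivative v x) (at x within {0..})"
    using traj unfolding is_trajectory_def
    by (auto elim!: AE_E3 simp: null_sets_restrict_space)
  have "norm ((r t + exp (- t) *\<^sub>R w) - (r 0 + exp (- 0) *\<^sub>R w)) \<le> (t + exp (- t)) - (0 + exp (- 0))"
  proof (rule norm_increment_le_of_AE_derivative[OF \<open>0 \<le> t\<close> _ _ N])
    have "absolutely_continuous_fun_on 0 t (\<lambda>x. exp (- x) *\<^sub>R w)"
      by (rule absolutely_continuous_fun_on_of_C1[where f' = "\<lambda>x. - exp (- x) *\<^sub>R w"])
         (auto intro!: derivative_eq_intros continuous_intros)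
    then show "absolutely_continuous_fun_on 0 t (\<lambda>x. r x + exp (- x) *\<^sub>R w)"
      using traj \<open>0 \<le> t\<close> by (intro absolutely_continuous_fun_on_add) (auto simp: is_trajectory_def)
  next
    show "mono_on {0..t} (\<lambda>x. x + exp (- x))"
    proof (rule mono_onI)
      fix x y assume xy: "x \<in> {0..t}" "y \<in> {0..t}" "x \<le> y"
      show "x + exp (- x) \<le> y + exp (- y)"
      proof (rule DERIV_nonneg_imp_nondecreasing[OF xy(3)])
        fix z assume "x \<le> z" "z \<le> y"
        then show "\<exists>D. ((\<lambda>x. x + exp (- x)) has_real_derivative D) (at z) \<and> 0 \<le> D"
          using xy(1) by (intro exI[of _ "1 - exp (- z)"]) (auto intro!: derivative_eq_intros)
      qed
    qed
  next
    fix x assume x: "x \<in> {0..t} - N"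
    then have "(r has_vector_derivative v x) (at x within {0..t})"
      by (intro has_vector_derivative_within_subset[OF r']) auto
    then show "((\<lambda>x. r x + exp (- x) *\<^sub>R w) has_vector_derivative v x - exp (- x) *\<^sub>R w) (at x within {0..t})"
      by (auto intro!: derivative_eq_intros)
    show "((\<lambda>x. x + exp (- x)) has_real_derivative 1 - exp (- x)) (at x within {0..t})"
      by (auto intro!: derivative_eq_intros)
    show "norm (v x - exp (- x) *\<^sub>R w) \<le> 1 - exp (- x)"
      using is_trajectory_velocity_bound[OF u traj] x by simp
  qed
  moreover have "r 0 = 0" using traj by (simp add: is_trajectory_def)
  ultimately show ?thesis by (simp add: algebra_simps)
qed

text \<open>
  Evaluated at a fixed time, both components map the unit ball of controls \<open>c\<close>
  onto the ball that the upper bounds allow, so constant controls reach every admissible point.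
\<close>

lemma constant_control_is_trajectory:
  "is_trajectory w (\<lambda>_. c)
     (\<lambda>s. (1 - exp (- s)) *\<^sub>R w + (s - 1 + exp (- s)) *\<^sub>R c)
     (\<lambda>s. exp (- s) *\<^sub>R w + (1 - exp (- s)) *\<^sub>R c)"
  (is "is_trajectory w _ ?r ?v")
proof -
  have r': "(?r has_vector_derivative ?v s) (at s within S)" for s S
    by (auto intro!: derivative_eq_intros)
  have v': "(?v has_vector_derivative c - ?v s) (at s within S)" for s S
    by (auto intro!: derivative_eq_intros simp: algebra_simps)
  have "absolutely_continuous_fun_on 0 T ?r" "absolutely_continuous_fun_on 0 T ?v" for T
    by (rule absolutely_continuous_fun_on_of_C1, rule r', intro continuous_intros)
       (rule absolutely_continuous_fun_on_of_C1, rule v', intro continuous_intros)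
  then show ?thesis
    unfolding is_trajectory_def using r' v' by auto
qed

lemma cball_eq_image_unit_cball:
  fixes p :: "'a::real_normed_vector"
  assumes "0 \<le> \<rho>"
  shows "cball p \<rho> = (\<lambda>c. p + \<rho> *\<^sub>R c) ` cball 0 1"
proof
  show "(\<lambda>c. p + \<rho> *\<^sub>R c) ` cball 0 1 \<subseteq> cball p \<rho>"
    using assms by (auto simp: dist_norm mult_left_le)
  show "cball p \<rho> \<subseteq> (\<lambda>c. p + \<rho> *\<^sub>R c) ` cball 0 1"
  proof
    fix x assume x: "x \<in> cball p \<rho>"
    show "x \<in> (\<lambda>c. p + \<rho> *\<^sub>R c) ` cball 0 1"
    proof (rule image_eqI)
      show "x = p + \<rho> *\<^sub>R ((1 / \<rho>) *\<^sub>R (x - p))"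
        using x by (cases "\<rho> = 0") auto
      show "(1 / \<rho>) *\<^sub>R (x - p) \<in> cball 0 1"
        using x assms by (cases "\<rho> = 0") (auto simp: dist_norm norm_minus_commute)
    qed
  qed
qed

lemma reach_eq_cball:
  fixes w :: "real ^ 'n"
  assumes "0 \<le> t"
  shows "reach_position w t = cball ((1 - exp (- t)) *\<^sub>R w) (t - 1 + exp (- t))"
    and "reach_velocity w t = cball (exp (- t) *\<^sub>R w) (1 - exp (- t))"
proof -
  have rad: "0 \<le> t - 1 + exp (- t)" "0 \<le> 1 - exp (- t)"
    using exp_ge_add_one_self[of "- t"] assms by simp_all
  have const: "(\<lambda>_. c) \<in> admissible_controls" if "c \<in> cball 0 1" for c :: "real ^ 'n"
    using that by (simp add: admissible_controls_def)
  have mem_position: "r t \<in> reach_position w t" and mem_velocity: "v t \<in> reach_velocity w t"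
    if "u \<in> admissible_controls" "is_trajectory w u r v" for u r v
    using that unfolding reach_position_def reach_velocity_def by blast+
  show "reach_position w t = cball ((1 - exp (- t)) *\<^sub>R w) (t - 1 + exp (- t))"
  proof
    show "reach_position w t \<subseteq> cball ((1 - exp (- t)) *\<^sub>R w) (t - 1 + exp (- t))"
      using is_trajectory_position_bound[OF _ _ assms]
      by (auto simp: reach_position_def dist_norm norm_minus_commute)
    show "cball ((1 - exp (- t)) *\<^sub>R w) (t - 1 + exp (- t)) \<subseteq> reach_position w t"
      unfolding cball_eq_image_unit_cball[OF rad(1)]
    proof (rule image_subsetI)
      fix c :: "real ^ 'n" assume "c \<in> cball 0 1"
      from mem_position[OF const[OF this] constant_control_is_trajectory]
      show "(1 - exp (- t)) *\<^sub>R w + (t - 1 + exp (- t)) *\<^sub>R c \<in> reach_position w t" .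
    qed
  qed
  show "reach_velocity w t = cball (exp (- t) *\<^sub>R w) (1 - exp (- t))"
  proof
    show "reach_velocity w t \<subseteq> cball (exp (- t) *\<^sub>R w) (1 - exp (- t))"
      using is_trajectory_velocity_bound[OF _ _ assms]
      by (auto simp: reach_velocity_def dist_norm norm_minus_commute)
    show "cball (exp (- t) *\<^sub>R w) (1 - exp (- t)) \<subseteq> reach_velocity w t"
      unfolding cball_eq_image_unit_cball[OF rad(2)]
    proof (rule image_subsetI)
      fix c :: "real ^ 'n" assume "c \<in> cball 0 1"
      from mem_velocity[OF const[OF this] constant_control_is_trajectory]
      show "exp (- t) *\<^sub>R w + (1 - exp (- t)) *\<^sub>R c \<in> reach_velocity w t" .
    qed
  qed
qed

section \<open>Distance to a ball\<close>

lemma min_distance_cball: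
  assumes "0 \<le> \<rho>"
  shows "min_distance (cball p \<rho>) h = max 0 (norm (h - p) - \<rho>)"
  unfolding min_distance_def
proof (rule Least_equality)
  show "max 0 (norm (h - p) - \<rho>) \<in> (\<lambda>h'. norm (h - h')) ` cball p \<rho>"
  proof (cases "norm (h - p) \<le> \<rho>")
    case True
    then show ?thesis
      by (intro image_eqI[of _ _ h]) (auto simp: dist_norm norm_minus_commute)
  next
    case False
    \<comment> \<open>The minimum is attained at the radial projection of \<open>h\<close> onto the sphere.\<close>
    define n where "n = norm (h - p)"
    have n: "n > \<rho>" "n > 0" using False assms by (auto simp: n_def)
    show ?thesis
    proof (rule image_eqI)
      show "p + (\<rho> / n) *\<^sub>R (h - p) \<in> cball p \<rho>"
        using n assms by (simp add: dist_norm flip: n_def)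
      have "h - (p + (\<rho> / n) *\<^sub>R (h - p)) = (1 - \<rho> / n) *\<^sub>R (h - p)"
        by (simp add: algebra_simps)
      also have "norm \<dots> = (1 - \<rho> / n) * n"
        using n by (simp add: n_def)
      also have "\<dots> = n - \<rho>"
        using n by (simp add: field_simps)
      finally show "max 0 (norm (h - p) - \<rho>) = norm (h - (p + (\<rho> / n) *\<^sub>R (h - p)))"
        using n by (simp flip: n_def)
    qed
  qed
next
  fix d assume "d \<in> (\<lambda>h'. norm (h - h')) ` cball p \<rho>"
  then obtain h' where "d = norm (h - h')" "norm (h' - p) \<le> \<rho>"
    by (auto simp: dist_norm norm_minus_commute[of p])
  then show "max 0 (norm (h - p) - \<rho>) \<le> d"
    using norm_triangle_ineq[of "h - h'" "h' - p"] by simp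
qed

theorem mainTheorem2:
  fixes v0 t :: real and k :: "'n::finite" and w :: "real ^ 'n"
  assumes "0 \<le> v0" and "v0 < 1"
    and "w = axis k v0"
    and "0 \<le> t"
  shows "reach_position w t = cball ((1 - exp (- t)) *\<^sub>R w) (t - 1 + exp (- t)) \<and>
         reach_velocity w t = cball (exp (- t) *\<^sub>R w) (1 - exp (- t)) \<and>
         (\<forall>h. min_distance (reach_position w t) h
                = max 0 (norm (h - (1 - exp (- t)) *\<^sub>R w) - (t - 1 + exp (- t))) \<and>
              min_distance (reach_velocity w t) h
                = max 0 (norm (h - exp (- t) *\<^sub>R w) - (1 - exp (- t))))"
proof -
  have "0 \<le> t - 1 + exp (- t)" "0 \<le> 1 - exp (- t)"
    using exp_ge_add_one_self[of "- t"] \<open>0 \<le> t\<close> by simp_all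
  then show ?thesis
    using reach_eq_cball[OF \<open>0 \<le> t\<close>, of w] by (simp add: min_distance_cball)
qed

end
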